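(* Let $(f,\Lambda)$, with $f\in\mathcal H_0(V)$ and $\Lambda\in\mathbb R$, be an eigenpair satisfying, for all $u\in V_I$, the $\infty$-limit eigenvalue equation $$0=\begin{cases}\min\{\|\{\nabla f\}(u)\|_\infty-\Lambda f(u),\ \Delta_\infty f(u)\} & \text{if } f(u)>0,\\ \Delta_\infty f(u) & \text{if } f(u)=0,\\ \max\{-\|\{\nabla f\}(u)\|_\infty-\Lambda f(u),\ \Delta_\infty f(u)\} & \text{if } f(u)<0,\end{cases}$$ and assume that $f$ induces $k$ nodal domains. Then $\Lambda\ge \dfrac1{R_k}$.
   Context: $G=(V,E,\omega)$ is a finite undirected weighted graph: $E\subset V\times V$ is symmetric and $\omega_{uv}=\omega_{vu}>0$ for $(u,v)\in E$; $u\sim v$ means $(u,v)\in E$. $B\subset V$ (possibly empty) is the boundary and $V_I=V\setminus B$ is the set of internal nodes. $G$ is assumed connected: if $B=\emptyset$ any two nodes are joined by a path; if $B\ne\emptyset$ the subgraph induced by $V_I$ is connected. $\mathcal H_0(V)=\{f:V\to\mathbb R:\ f=0 \text{ on } B\}$. For $f\in\mathcal H_0(V)$: $\nabla f(u,v)=\omega_{uv}(f(v)-f(u))$ for $(u,v)\in E$. With $x^+=\max\{x,0\}$ and $x^-=\max\{-x,0\}$, set $\|\{\nabla f\}(u)\|_\infty=\max_{v\sim u}|\nabla f(u,v)|$, $\|\{\nabla f\}^{\pm}(u)\|_\infty=\max_{v\sim u}(\nabla f(u,v))^{\pm}$, and $\Delta_\infty f(u)=\|\{\nabla f\}^-(u)\|_\infty-\|\{\nabla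 f\}^+(u)\|_\infty$. The nodal domains induced by $f$ are the maximal connected subgraphs where $f$ is strictly positive or strictly negative. The length of a path $v_0\sim v_1\sim\dots\sim v_n$ is $\sum_{i=1}^n\omega_{v_{i-1}v_i}^{-1}$; $d(u,v)$ is the minimal length of a path joining $u$ and $v$, and $d_B(u)=\min_{v\in B}d(u,v)$; if $B=\emptyset$ the boundary is regarded as lying at infinite distance, $d_B\equiv+\infty$. The $k$-th packing radius is $R_k=\max\{r>0:\ \exists\,u_1,\dots,u_k\in V_I \text{ with } d(u_i,u_j)\ge 2r \text{ for all } i\neq j \text{ and } d_B(u_i)\ge r \text{ for all } i=1,\dots,k\}$ (if $B=\emptyset$ and $k=1$, this is read as $R_1=+\infty$, $1/R_1=0$).
   Formalization: Added assumption: if ∇f vanishes on every edge, then Λ ≥ 0. Without it the claim fails: for B = ∅, f a positive constant and Λ = −1, the equation holds with k = 1 and 1/R_1 = 0 > Λ. Only such false cases are excluded. *)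

theory Defs
  imports Complex_Main "HOL-Library.Extended_Real" "HOL-Library.FuncSet"
begin

definition weighted_graph :: "'a set \<Rightarrow> ('a \<times> 'a) set \<Rightarrow> ('a \<Rightarrow> 'a \<Rightarrow> real) \<Rightarrow> bool" where
  "weighted_graph V E \<omega> \<longleftrightarrow>
     finite V \<and> E \<subseteq> V \<times> V \<and> sym E \<and> (\<forall>(u, v) \<in> E. \<omega> u v = \<omega> v u \<and> \<omega> u v > 0)"

definition path_in :: "('a \<times> 'a) set \<Rightarrow> 'a set \<Rightarrow> 'a \<Rightarrow> 'a \<Rightarrow> 'a list \<Rightarrow> bool" where
  "path_in E S u v p \<longleftrightarrow>
     p \<noteq> [] \<and> hd p = u \<and> last p = v \<and> set p \<subseteq> S \<and> successively (\<lambda>x y. (x, y) \<in> E) p"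

definition induced_connected :: "('a \<times> 'a) set \<Rightarrow> 'a set \<Rightarrow> bool" where
  "induced_connected E S \<longleftrightarrow> (\<forall>u\<in>S. \<forall>v\<in>S. \<exists>p. path_in E S u v p)"

text \<open>Only the values on \<open>V\<close> of a function \<open>f :: 'a \<Rightarrow> real\<close> matter.\<close>

definition H0 :: "'a set \<Rightarrow> ('a \<Rightarrow> real) set" where
  "H0 B = {f. \<forall>u\<in>B. f u = 0}"

definition grad :: "('a \<Rightarrow> 'a \<Rightarrow> real) \<Rightarrow> ('a \<Rightarrow> real) \<Rightarrow> 'a \<Rightarrow> 'a \<Rightarrow> real" where
  "grad \<omega> f u v = \<omega> u v * (f v - f u)"

text \<open>The \<open>0\<close> inserted below does not change the maximum of a nonempty family of nonnegative
  numbers; it fixes the value at a node without neighbours.\<close>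

definition grad_norm :: "('a \<times> 'a) set \<Rightarrow> ('a \<Rightarrow> 'a \<Rightarrow> real) \<Rightarrow> ('a \<Rightarrow> real) \<Rightarrow> 'a \<Rightarrow> real" where
  "grad_norm E \<omega> f u = Max (insert 0 ((\<lambda>v. \<bar>grad \<omega> f u v\<bar>) ` {v. (u, v) \<in> E}))"

definition grad_pos_norm :: "('a \<times> 'a) set \<Rightarrow> ('a \<Rightarrow> 'a \<Rightarrow> real) \<Rightarrow> ('a \<Rightarrow> real) \<Rightarrow> 'a \<Rightarrow> real" where
  "grad_pos_norm E \<omega> f u = Max (insert 0 ((\<lambda>v. max (grad \<omega> f u v) 0) ` {v. (u, v) \<in> E}))"

definition grad_neg_norm :: "('a \<times> 'a) set \<Rightarrow> ('a \<Rightarrow> 'a \<Rightarrow> real) \<Rightarrow> ('a \<Rightarrow> real) \<Rightarrow> 'a \<Rightarrow> real" where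
  "grad_neg_norm E \<omega> f u = Max (insert 0 ((\<lambda>v. max (- grad \<omega> f u v) 0) ` {v. (u, v) \<in> E}))"

definition infty_laplacian :: "('a \<times> 'a) set \<Rightarrow> ('a \<Rightarrow> 'a \<Rightarrow> real) \<Rightarrow> ('a \<Rightarrow> real) \<Rightarrow> 'a \<Rightarrow> real" where
  "infty_laplacian E \<omega> f u = grad_neg_norm E \<omega> f u - grad_pos_norm E \<omega> f u"

definition limit_eigen_eq ::
  "('a \<times> 'a) set \<Rightarrow> ('a \<Rightarrow> 'a \<Rightarrow> real) \<Rightarrow> ('a \<Rightarrow> real) \<Rightarrow> real \<Rightarrow> 'a \<Rightarrow> bool" where
  "limit_eigen_eq E \<omega> f \<Lambda> u \<longleftrightarrow>
     0 = (if f u > 0 then min (grad_norm E \<omega> f u - \<Lambda> * f u) (infty_laplacian E \<omega> f u)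
          else if f u = 0 then infty_laplacian E \<omega> f u
          else max (- grad_norm E \<omega> f u - \<Lambda> * f u) (infty_laplacian E \<omega> f u))"

text \<open>The equation alone does not determine the sign of \<open>\<Lambda>\<close> when the gradient of \<open>f\<close> vanishes
  identically: if \<open>B = {}\<close>, a nonzero constant function satisfies it for every \<open>\<Lambda> \<le> 0\<close>.\<close>

definition limit_eigenpair ::
  "'a set \<Rightarrow> ('a \<times> 'a) set \<Rightarrow> ('a \<Rightarrow> 'a \<Rightarrow> real) \<Rightarrow> 'a set \<Rightarrow> ('a \<Rightarrow> real) \<Rightarrow> real \<Rightarrow> bool" where
  "limit_eigenpair V E \<omega> B f \<Lambda> \<longleftrightarrow>
     f \<in> H0 B \<and> (\<exists>u\<in>V. f u \<noteq> 0) \<and> (\<forall>u\<in>V - B. limit_eigen_eq E \<omega> f \<Lambda> u)"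

text \<open>A nodal domain is an induced subgraph and is represented by its set of vertices.\<close>

definition sign_connected :: "'a set \<Rightarrow> ('a \<times> 'a) set \<Rightarrow> ('a \<Rightarrow> real) \<Rightarrow> 'a set \<Rightarrow> bool" where
  "sign_connected V E f A \<longleftrightarrow>
     A \<noteq> {} \<and> A \<subseteq> V \<and> induced_connected E A \<and> ((\<forall>u\<in>A. f u > 0) \<or> (\<forall>u\<in>A. f u < 0))"

definition nodal_domains :: "'a set \<Rightarrow> ('a \<times> 'a) set \<Rightarrow> ('a \<Rightarrow> real) \<Rightarrow> 'a set set" where
  "nodal_domains V E f =
     {A. sign_connected V E f A \<and> (\<forall>A'. sign_connected V E f A' \<longrightarrow> A \<subseteq> A' \<longrightarrow> A' = A)}"

definition path_length :: "('a \<Rightarrow> 'a \<Rightarrow> real) \<Rightarrow> 'a list \<Rightarrow> real" where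
  "path_length \<omega> p = (\<Sum>i<length p - 1. 1 / \<omega> (p ! i) (p ! Suc i))"

text \<open>Infima over the empty set are \<open>\<infinity>\<close>: nodes not joined by a path are at infinite distance, and
  so is an empty boundary.\<close>

definition path_dist :: "'a set \<Rightarrow> ('a \<times> 'a) set \<Rightarrow> ('a \<Rightarrow> 'a \<Rightarrow> real) \<Rightarrow> 'a \<Rightarrow> 'a \<Rightarrow> ereal" where
  "path_dist V E \<omega> u v = (INF p \<in> {p. path_in E V u v p}. ereal (path_length \<omega> p))"

definition boundary_dist ::
  "'a set \<Rightarrow> ('a \<times> 'a) set \<Rightarrow> ('a \<Rightarrow> 'a \<Rightarrow> real) \<Rightarrow> 'a set \<Rightarrow> 'a \<Rightarrow> ereal" where
  "boundary_dist V E \<omega> B u = (INF v \<in> B. path_dist V E \<omega> u v)"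

definition packable ::
  "'a set \<Rightarrow> ('a \<times> 'a) set \<Rightarrow> ('a \<Rightarrow> 'a \<Rightarrow> real) \<Rightarrow> 'a set \<Rightarrow> nat \<Rightarrow> ereal \<Rightarrow> bool" where
  "packable V E \<omega> B k r \<longleftrightarrow>
     (\<exists>u. (\<forall>i\<in>{1..k}. u i \<in> V - B) \<and>
          (\<forall>i\<in>{1..k}. \<forall>j\<in>{1..k}. i \<noteq> j \<longrightarrow> path_dist V E \<omega> (u i) (u j) \<ge> 2 * r) \<and>
          (\<forall>i\<in>{1..k}. boundary_dist V E \<omega> B (u i) \<ge> r))"

text \<open>The radii range over the extended reals, so that the supremum is \<open>\<infinity>\<close> when \<open>k = 1\<close> and the
  boundary is empty. It is a maximum as soon as the set is nonempty (see below).\<close>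

definition packing_radius ::
  "'a set \<Rightarrow> ('a \<times> 'a) set \<Rightarrow> ('a \<Rightarrow> 'a \<Rightarrow> real) \<Rightarrow> 'a set \<Rightarrow> nat \<Rightarrow> ereal" where
  "packing_radius V E \<omega> B k = Sup {r. r > 0 \<and> packable V E \<omega> B k r}"

lemma packing_radius_is_max:
  assumes "finite V" and "r > 0" and "packable V E \<omega> B k r"
  shows "packing_radius V E \<omega> B k > 0 \<and> packable V E \<omega> B k (packing_radius V E \<omega> B k)"
proof -
  define S where "S = {r. r > 0 \<and> packable V E \<omega> B k r}"
  define F where "F = PiE {1..k} (\<lambda>_. V - B)"
  define T where "T u = {r :: ereal. r > 0 \<and>
      (\<forall>i\<in>{1..k}. \<forall>j\<in>{1..k}. i \<noteq> j \<longrightarrow> 2 * r \<le> path_dist V E \<omega> (u i) (u j)) \<and>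
      (\<forall>i\<in>{1..k}. r \<le> boundary_dist V E \<omega> B (u i))}" for u :: "nat \<Rightarrow> 'a"
  have fin: "finite F"
    unfolding F_def using assms(1) by (intro finite_PiE) auto
  have S_eq: "S = (\<Union>u\<in>F. T u)"
  proof (intro set_eqI iffI)
    fix s assume "s \<in> S"
    then obtain u where u: "\<forall>i\<in>{1..k}. u i \<in> V - B" "s \<in> T u"
      unfolding S_def packable_def T_def by auto
    have "restrict u {1..k} \<in> F" "s \<in> T (restrict u {1..k})"
      using u unfolding F_def T_def by auto
    then show "s \<in> (\<Union>u\<in>F. T u)" by blast
  next
    fix s assume "s \<in> (\<Union>u\<in>F. T u)"
    then obtain u where "u \<in> F" "s \<in> T u" by blast
    then show "s \<in> S"
      unfolding S_def packable_def T_def F_def by (auto intro!: exI[of _ u] simp: PiE_iff)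
  qed
  have half: "2 * s \<le> c \<longleftrightarrow> s \<le> c / 2" for s c :: ereal
    by (cases s; cases c) (auto simp: field_simps)
  have Sup_T: "Sup (T u) \<in> T u" if "T u \<noteq> {}" for u
  proof -
    from that obtain s where s: "s \<in> T u" by blast
    then have "0 < Sup (T u)"
      by (metis (mono_tags, lifting) Sup_upper T_def mem_Collect_eq order_less_le_trans)
    then show ?thesis
      unfolding T_def half by (auto intro!: Sup_least)
  qed
  define G where "G = {u \<in> F. T u \<noteq> {}}"
  have "r \<in> S" using assms(2,3) by (simp add: S_def)
  then have G: "finite G" "G \<noteq> {}" using fin S_eq unfolding G_def by auto
  have "Sup S = Sup ((\<lambda>u. Sup (T u)) ` G)"
    unfolding S_eq by (rule antisym) (force simp: G_def intro!: Sup_least Sup_upper2 intro: Sup_subset_mono)+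
  also have "\<dots> = Max ((\<lambda>u. Sup (T u)) ` G)"
    using G by (intro Max_Sup[symmetric]) auto
  also have "\<dots> \<in> (\<lambda>u. Sup (T u)) ` G"
    using G by (intro Max_in) auto
  also have "\<dots> \<subseteq> S"
    using Sup_T unfolding S_eq G_def by blast
  finally show ?thesis unfolding packing_radius_def S_def by blast
qed

end

theory Submission
  imports Defs
begin

text \<open>
  A lower bound on the packing radius only needs one good packing, and the nodal domains supply it:
  choose in every domain \<open>A\<close> a point \<open>u\<^sub>A\<close> where \<open>\<bar>f\<bar>\<close> attains its maximum \<open>M\<^sub>A\<close> over \<open>A\<close>. These
  points turn out to have pairwise distance at least \<open>2 / \<Lambda>\<close> and distance at least \<open>1 / \<Lambda>\<close> from the
  boundary, so that the packing radius is at least \<open>1 / \<Lambda>\<close>.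

  The analytic input is the gradient bound \<open>\<bar>\<nabla>f\<bar> \<le> \<Lambda> M\<^sub>A\<close> on \<open>A\<close> (\<open>grad_norm_le_peak\<close>). At a point of
  \<open>A\<close> the equation says that either the gradient norm equals \<open>\<Lambda> \<bar>f\<bar>\<close>, which is what is wanted, or
  the infinity Laplacian vanishes, so that the steepest descent is matched by an equally steep
  ascent. In the second case, unless the gradient is zero, the neighbour in the ascending direction
  has a strictly larger value of \<open>\<bar>f\<bar>\<close>, the same sign and at least the same gradient norm. As \<open>A\<close> is finite, such an ascent must end
  at a point of the first kind. The same ascent shows that a nonvanishing gradient forces \<open>\<Lambda> > 0\<close>;
  when the gradient vanishes identically, \<open>\<Lambda> \<ge> 0\<close> is a hypothesis.

  The bound makes the rescaled function \<open>\<bar>f\<bar> / M\<^sub>A\<close> on \<open>A\<close>, extended by \<open>0\<close>, a \<open>\<Lambda>\<close>-Lipschitz function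
  for the path metric which drops from \<open>1\<close> at \<open>u\<^sub>A\<close> to \<open>0\<close> on the boundary. The difference of two such
  functions for distinct domains is again \<open>\<Lambda>\<close>-Lipschitz (\<open>nodal_height_diff_lipschitz\<close>), and it
  drops from \<open>1\<close> to \<open>-1\<close>. Both distance estimates are then instances of the fact that an
  \<open>L\<close>-Lipschitz function needs length \<open>c / L\<close> to change by \<open>c\<close>. With \<open>1 / 0 = \<infinity>\<close> this covers \<open>\<Lambda> = 0\<close>
  as well: a \<open>0\<close>-Lipschitz function is constant along paths, so no path joins the points in question.
\<close>

section \<open>Lipschitz functions and the path metric\<close>

lemma path_length_Cons_Cons:
  "path_length \<omega> (x # y # p) = 1 / \<omega> x y + path_length \<omega> (y # p)"
  by (simp add: path_length_def sum.lessThan_Suc_shift del: sum.lessThan_Suc)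

lemma lipschitz_along_path:
  assumes lip: "\<And>x y. (x, y) \<in> E \<Longrightarrow> \<bar>\<phi> x - \<phi> y\<bar> \<le> L / \<omega> x y"
    and "path_in E S u v p"
  shows "\<bar>\<phi> u - \<phi> v\<bar> \<le> L * path_length \<omega> p"
proof -
  have "\<bar>\<phi> (hd p) - \<phi> (last p)\<bar> \<le> L * path_length \<omega> p"
    if "p \<noteq> []" "successively (\<lambda>x y. (x, y) \<in> E) p"
    using that
  proof (induction p rule: induct_list012)
    case (3 x y p)
    have "\<bar>\<phi> x - \<phi> y\<bar> \<le> L / \<omega> x y"
      using 3 by (intro lip) simp
    moreover have "\<bar>\<phi> y - \<phi> (last (y # p))\<bar> \<le> L * path_length \<omega> (y # p)"
      using 3 by simp
    ultimately show ?case
      unfolding path_length_Cons_Cons by (simp add: distrib_left)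
  qed (auto simp: path_length_def)
  then show ?thesis
    using assms(2) by (simp add: path_in_def)
qed

lemma path_dist_ge_lipschitz:
  assumes lip: "\<And>x y. (x, y) \<in> E \<Longrightarrow> \<bar>\<phi> x - \<phi> y\<bar> \<le> L / \<omega> x y"
    and "0 \<le> L" "0 < c" "c \<le> \<bar>\<phi> u - \<phi> v\<bar>"
  shows "ereal c * (1 / ereal L) \<le> path_dist V E \<omega> u v"
  unfolding path_dist_def
proof (rule INF_greatest)
  fix p assume "p \<in> {p. path_in E V u v p}"
  then have le: "c \<le> L * path_length \<omega> p"
    using lipschitz_along_path[of E \<phi> L \<omega> V u v p] lip assms(4) by fastforce
  then have "L > 0"
    using assms(2,3) by (cases "L = 0") auto
  then show "ereal c * (1 / ereal L) \<le> ereal (path_length \<omega> p)"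
    using le by (simp add: one_ereal_def field_simps)
qed

section \<open>The gradient at a vertex\<close>

lemma finite_neighbours:
  assumes "weighted_graph V E \<omega>"
  shows "finite {v. (u, v) \<in> E}"
  using assms unfolding weighted_graph_def by (auto intro: finite_subset[of _ V])

lemma grad_swap:
  assumes "weighted_graph V E \<omega>" "(u, v) \<in> E"
  shows "grad \<omega> f v u = - grad \<omega> f u v"
  using assms unfolding weighted_graph_def grad_def by (auto simp: algebra_simps)

lemma abs_grad_le_grad_norm:
  assumes "weighted_graph V E \<omega>" "(u, v) \<in> E"
  shows "\<bar>grad \<omega> f u v\<bar> \<le> grad_norm E \<omega> f u"
  unfolding grad_norm_def using finite_neighbours[OF assms(1)] assms(2) by (intro Max_ge) auto

text \<open>When the infinity Laplacian vanishes, the steepest ascent and the steepest descent have the same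
  slope, so both realise the gradient norm.\<close>

lemma steepest_directions:
  assumes G: "weighted_graph V E \<omega>"
    and "infty_laplacian E \<omega> f u = 0" "0 < grad_norm E \<omega> f u"
  shows "\<exists>v. (u, v) \<in> E \<and> grad_norm E \<omega> f u \<le> grad \<omega> f u v"
    and "\<exists>v. (u, v) \<in> E \<and> grad_norm E \<omega> f u \<le> - grad \<omega> f u v"
proof -
  let ?N = "{v. (u, v) \<in> E}"
  note fin = finite_neighbours[OF G, of u]
  have eq: "grad_pos_norm E \<omega> f u = grad_neg_norm E \<omega> f u"
    using assms(2) by (simp add: infty_laplacian_def)
  have pos: "grad \<omega> f u v \<le> grad_pos_norm E \<omega> f u" if "(u, v) \<in> E" for v
  proof -
    have "max (grad \<omega> f u v) 0 \<le> grad_pos_norm E \<omega> f u"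
      unfolding grad_pos_norm_def using fin that by (intro Max_ge) auto
    then show ?thesis by simp
  qed
  have neg: "- grad \<omega> f u v \<le> grad_neg_norm E \<omega> f u" if "(u, v) \<in> E" for v
  proof -
    have "max (- grad \<omega> f u v) 0 \<le> grad_neg_norm E \<omega> f u"
      unfolding grad_neg_norm_def using fin that by (intro Max_ge) auto
    then show ?thesis by simp
  qed
  have "grad_norm E \<omega> f u \<in> insert 0 ((\<lambda>v. \<bar>grad \<omega> f u v\<bar>) ` ?N)"
    unfolding grad_norm_def using fin by (intro Max_in) auto
  then have le: "grad_norm E \<omega> f u \<le> grad_pos_norm E \<omega> f u"
    using assms(3) pos neg eq by (fastforce simp: abs_if)
  have "grad_pos_norm E \<omega> f u \<in> insert 0 ((\<lambda>v. max (grad \<omega> f u v) 0) ` ?N)"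
    unfolding grad_pos_norm_def using fin by (intro Max_in) auto
  then show "\<exists>v. (u, v) \<in> E \<and> grad_norm E \<omega> f u \<le> grad \<omega> f u v"
    using le assms(3) by (fastforce simp: max_def split: if_splits)
  have "grad_neg_norm E \<omega> f u \<in> insert 0 ((\<lambda>v. max (- grad \<omega> f u v) 0) ` ?N)"
    unfolding grad_neg_norm_def using fin by (intro Max_in) auto
  then show "\<exists>v. (u, v) \<in> E \<and> grad_norm E \<omega> f u \<le> - grad \<omega> f u v"
    using le eq assms(3) by (fastforce simp: max_def split: if_splits)
qed

text \<open>The dichotomy that the eigenvalue equation expresses away from the zeros of \<open>f\<close>. The factor
  \<open>sgn (f u)\<close> turns an increase of \<open>f\<close> into an increase of \<open>\<bar>f\<bar>\<close>, so that both signs are treated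
  alike.\<close>

lemma limit_eigen_eq_dichotomy:
  assumes G: "weighted_graph V E \<omega>"
    and "limit_eigen_eq E \<omega> f \<Lambda> u" "f u \<noteq> 0" "0 < grad_norm E \<omega> f u"
  shows "grad_norm E \<omega> f u \<le> \<Lambda> * \<bar>f u\<bar> \<or>
    (\<exists>v. (u, v) \<in> E \<and> grad_norm E \<omega> f u \<le> sgn (f u) * grad \<omega> f u v)"
proof (cases "infty_laplacian E \<omega> f u = 0")
  case True
  then show ?thesis
    using steepest_directions[OF G True assms(4)] assms(3) by (cases "f u > 0") auto
next
  case False
  then show ?thesis
    using assms(2,3) unfolding limit_eigen_eq_def
    by (auto simp: min_def max_def split: if_splits)
qed

text \<open>An ascent along steepest edges stays inside any set of nonzeros that is closed under passing to
  neighbours of the same sign, and it keeps the gradient norm from decreasing. Its end point is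
  found as a maximiser of \<open>\<bar>f\<bar>\<close> among all points with gradient norm at least that of \<open>x\<close>. The lemma
  is applied both to single nodal domains and to the set of all nonzeros of \<open>f\<close>.\<close>

lemma ascent_to_saturation:
  assumes G: "weighted_graph V E \<omega>"
    and "finite A" "\<And>x. x \<in> A \<Longrightarrow> f x \<noteq> 0" "\<And>x. x \<in> A \<Longrightarrow> limit_eigen_eq E \<omega> f \<Lambda> x"
    and closed: "\<And>x y. x \<in> A \<Longrightarrow> (x, y) \<in> E \<Longrightarrow> sgn (f x) = sgn (f y) \<Longrightarrow> y \<in> A"
    and "x \<in> A" "0 < grad_norm E \<omega> f x"
  shows "\<exists>z\<in>A. grad_norm E \<omega> f x \<le> \<Lambda> * \<bar>f z\<bar>"
proof -
  define S where "S = {z \<in> A. grad_norm E \<omega> f x \<le> grad_norm E \<omega> f z}"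
  have "finite S" "S \<noteq> {}"
    using assms by (auto simp: S_def)
  then have "Max ((\<lambda>z. \<bar>f z\<bar>) ` S) \<in> (\<lambda>z. \<bar>f z\<bar>) ` S"
    by (intro Max_in) auto
  then obtain z where z: "z \<in> S" "\<bar>f z\<bar> = Max ((\<lambda>z. \<bar>f z\<bar>) ` S)"
    by auto
  have zmax: "\<bar>f y\<bar> \<le> \<bar>f z\<bar>" if "y \<in> S" for y
    using z(2) that \<open>finite S\<close> by simp
  have zA: "z \<in> A" "grad_norm E \<omega> f x \<le> grad_norm E \<omega> f z"
    using z(1) by (auto simp: S_def)
  have "grad_norm E \<omega> f z \<le> \<Lambda> * \<bar>f z\<bar>"
  proof (rule ccontr)
    assume "\<not> ?thesis"
    then obtain y where y: "(z, y) \<in> E" "grad_norm E \<omega> f z \<le> sgn (f z) * grad \<omega> f z y"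
      using limit_eigen_eq_dichotomy[OF G assms(4)[OF zA(1)] assms(3)[OF zA(1)]] zA(2) assms(7)
      by fastforce
    have "\<omega> z y > 0"
      using G y(1) unfolding weighted_graph_def by auto
    moreover have "0 < \<omega> z y * (sgn (f z) * (f y - f z))"
      using y(2) zA(2) assms(7) by (simp add: grad_def algebra_simps)
    ultimately have up: "0 < sgn (f z) * (f y - f z)"
      by (simp add: zero_less_mult_iff)
    then have "sgn (f z) = sgn (f y)" and larger: "\<bar>f z\<bar> < \<bar>f y\<bar>"
      using assms(3)[OF zA(1)] by (auto simp: sgn_if split: if_splits)
    then have "y \<in> A"
      using closed zA(1) y(1) by blast
    moreover have "grad_norm E \<omega> f z \<le> grad_norm E \<omega> f y"
    proof -
      have "(y, z) \<in> E"
        using G y(1) unfolding weighted_graph_def sym_def by blast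
      then have "\<bar>grad \<omega> f y z\<bar> \<le> grad_norm E \<omega> f y"
        by (rule abs_grad_le_grad_norm[OF G])
      moreover have "sgn (f z) * grad \<omega> f z y \<le> \<bar>grad \<omega> f y z\<bar>"
        unfolding grad_swap[OF G y(1)] by (auto simp: sgn_if)
      ultimately show ?thesis
        using y(2) by linarith
    qed
    ultimately have "y \<in> S"
      using zA(2) by (auto simp: S_def)
    then show False
      using zmax larger by fastforce
  qed
  then show ?thesis
    using zA by force
qed

section \<open>Nodal domains\<close>

lemma path_in_append:
  assumes "path_in E S u x p" "path_in E S' x v q"
  shows "path_in E (S \<union> S') u v (p @ tl q)"
proof -
  obtain q' where "q = x # q'"
    using assms(2) unfolding path_in_def by (cases q) auto
  then show ?thesis
    using assms unfolding path_in_def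
    by (cases q') (auto simp: successively_append_iff)
qed

lemma path_in_mono:
  assumes "path_in E S u v p" "S \<subseteq> S'"
  shows "path_in E S' u v p"
  using assms unfolding path_in_def by auto

lemma sign_connected_Un:
  assumes A: "sign_connected V E f A" and A': "sign_connected V E f A'"
    and x: "x \<in> A" "x \<in> A'"
  shows "sign_connected V E f (A \<union> A')"
proof -
  have to_x: "\<exists>p. path_in E (A \<union> A') u x p" "\<exists>p. path_in E (A \<union> A') x u p"
    if "u \<in> A \<union> A'" for u
    using that A A' x unfolding sign_connected_def induced_connected_def
    by (meson UnE path_in_mono Un_upper1 Un_upper2)+
  have "induced_connected E (A \<union> A')"
    unfolding induced_connected_def
  proof (intro ballI)
    fix u v assume "u \<in> A \<union> A'" "v \<in> A \<union> A'"
    then obtain p q where "path_in E (A \<union> A') u x p" "path_in E (A \<union> A') x v q"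
      using to_x by meson
    then show "\<exists>p. path_in E (A \<union> A') u v p"
      using path_in_append by fastforce
  qed
  moreover have "(\<forall>u\<in>A \<union> A'. f u > 0) \<or> (\<forall>u\<in>A \<union> A'. f u < 0)"
    using A A' x unfolding sign_connected_def by (metis Un_iff less_asym)
  ultimately show ?thesis
    using A A' unfolding sign_connected_def by auto
qed

lemma nodal_domains_disjoint:
  assumes "A \<in> nodal_domains V E f" "A' \<in> nodal_domains V E f" "x \<in> A" "x \<in> A'"
  shows "A = A'"
  using assms sign_connected_Un[of V E f A A' x] unfolding nodal_domains_def by blast

text \<open>The edge itself is a sign-connected set meeting \<open>A\<close>, so maximality absorbs it.\<close>

lemma nodal_domain_closed:
  assumes G: "weighted_graph V E \<omega>"
    and A: "A \<in> nodal_domains V E f" and x: "x \<in> A"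
    and xy: "(x, y) \<in> E" and sgn: "sgn (f x) = sgn (f y)"
  shows "y \<in> A"
proof -
  have sc: "sign_connected V E f A"
    and max: "\<And>A'. sign_connected V E f A' \<Longrightarrow> A \<subseteq> A' \<Longrightarrow> A' = A"
    using A unfolding nodal_domains_def by auto
  have "(y, x) \<in> E" "x \<in> V" "y \<in> V"
    using G xy unfolding weighted_graph_def sym_def by auto
  moreover have "path_in E {x, y} x x [x]" "path_in E {x, y} y y [y]"
      "path_in E {x, y} x y [x, y]" "path_in E {x, y} y x [y, x]"
    using xy calculation by (auto simp: path_in_def)
  moreover have "f x \<noteq> 0"
    using sc x unfolding sign_connected_def by auto
  ultimately have "sign_connected V E f {x, y}"
    using sgn unfolding sign_connected_def induced_connected_def
    by (auto simp: sgn_if split: if_splits)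
  then have "sign_connected V E f (A \<union> {x, y})"
    using sign_connected_Un[OF sc _ x] by blast
  then show ?thesis
    using max by blast
qed

text \<open>By maximality of \<open>A\<close>, the value at a neighbour outside \<open>A\<close> is zero or has the opposite sign, so
  no cancellation takes place.\<close>

lemma abs_diff_across_rim:
  assumes "weighted_graph V E \<omega>" "A \<in> nodal_domains V E f" "x \<in> A" "(x, y) \<in> E" "y \<notin> A"
  shows "\<bar>f x - f y\<bar> = \<bar>f x\<bar> + \<bar>f y\<bar>"
proof -
  have "sgn (f x) \<noteq> sgn (f y)"
    using nodal_domain_closed assms by metis
  then show ?thesis
    by (auto simp: sgn_if split: if_splits)
qed

section \<open>Heights of nodal domains\<close>

definition peak :: "('a \<Rightarrow> real) \<Rightarrow> 'a set \<Rightarrow> real" where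
  "peak f A = Max ((\<lambda>v. \<bar>f v\<bar>) ` A)"

definition nodal_height :: "('a \<Rightarrow> real) \<Rightarrow> 'a set \<Rightarrow> 'a \<Rightarrow> real" where
  "nodal_height f A v = (if v \<in> A then \<bar>f v\<bar> / peak f A else 0)"

lemma nodal_domain_basics:
  assumes "weighted_graph V E \<omega>" "f \<in> H0 B" "A \<in> nodal_domains V E f"
  shows "finite A" "A \<noteq> {}" "A \<subseteq> V - B" "\<And>x. x \<in> A \<Longrightarrow> f x \<noteq> 0"
proof -
  have A: "A \<noteq> {}" "A \<subseteq> V" "(\<forall>u\<in>A. f u > 0) \<or> (\<forall>u\<in>A. f u < 0)" and V: "finite V"
    using assms unfolding nodal_domains_def sign_connected_def weighted_graph_def by auto
  show "A \<noteq> {}" "finite A" using A V finite_subset by auto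
  show *: "\<And>x. x \<in> A \<Longrightarrow> f x \<noteq> 0" using A(3) by force
  show "A \<subseteq> V - B" using A(2) * assms(2) unfolding H0_def by auto
qed

lemma abs_le_peak:
  assumes "finite A" "x \<in> A"
  shows "\<bar>f x\<bar> \<le> peak f A"
  unfolding peak_def using assms by (intro Max_ge) auto

lemma peak_attained:
  assumes "finite A" "A \<noteq> {}"
  shows "\<exists>u\<in>A. \<bar>f u\<bar> = peak f A"
proof -
  have "peak f A \<in> (\<lambda>v. \<bar>f v\<bar>) ` A"
    unfolding peak_def using assms by (intro Max_in) auto
  then show ?thesis by auto
qed

lemma peak_pos:
  assumes "weighted_graph V E \<omega>" "f \<in> H0 B" "A \<in> nodal_domains V E f"
  shows "0 < peak f A"
proof -
  note basics = nodal_domain_basics[OF assms]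
  obtain u where "u \<in> A" "\<bar>f u\<bar> = peak f A"
    using peak_attained[OF basics(1,2)] by blast
  then show ?thesis
    using basics(4)[of u] by linarith
qed

lemma grad_norm_le_peak:
  assumes G: "weighted_graph V E \<omega>" and eig: "limit_eigenpair V E \<omega> B f \<Lambda>"
    and "0 \<le> \<Lambda>" and A: "A \<in> nodal_domains V E f" and x: "x \<in> A"
  shows "grad_norm E \<omega> f x \<le> \<Lambda> * peak f A"
proof -
  have H: "f \<in> H0 B" using eig by (simp add: limit_eigenpair_def)
  show ?thesis
  proof (cases "0 < grad_norm E \<omega> f x")
    case True
    note basics = nodal_domain_basics[OF G H A]
    have eq: "limit_eigen_eq E \<omega> f \<Lambda> y" if "y \<in> A" for y
      using eig basics(3) that unfolding limit_eigenpair_def by auto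
    have closed: "z \<in> A" if "y \<in> A" "(y, z) \<in> E" "sgn (f y) = sgn (f z)" for y z
      using nodal_domain_closed[OF G A that] .
    have "\<exists>z\<in>A. grad_norm E \<omega> f x \<le> \<Lambda> * \<bar>f z\<bar>"
      using ascent_to_saturation[OF G basics(1,4) eq closed x True] .
    then obtain z where z: "z \<in> A" "grad_norm E \<omega> f x \<le> \<Lambda> * \<bar>f z\<bar>"
      by blast
    have "\<Lambda> * \<bar>f z\<bar> \<le> \<Lambda> * peak f A"
      using abs_le_peak[OF basics(1) z(1)] \<open>0 \<le> \<Lambda>\<close> by (rule mult_left_mono)
    then show ?thesis
      using z(2) by linarith
  next
    case False
    have "0 \<le> \<Lambda> * peak f A"
      using peak_pos[OF G H A] \<open>0 \<le> \<Lambda>\<close> by simp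
    then show ?thesis
      using False by linarith
  qed
qed

lemma edge_jump_le_peak:
  assumes G: "weighted_graph V E \<omega>" and "limit_eigenpair V E \<omega> B f \<Lambda>"
    and "0 \<le> \<Lambda>" "A \<in> nodal_domains V E f" "x \<in> A" and xy: "(x, y) \<in> E"
  shows "\<omega> x y * \<bar>f x - f y\<bar> \<le> \<Lambda> * peak f A"
proof -
  have "\<omega> x y > 0"
    using G xy unfolding weighted_graph_def by auto
  then have "\<omega> x y * \<bar>f x - f y\<bar> = \<bar>grad \<omega> f x y\<bar>"
    by (simp add: grad_def abs_mult abs_minus_commute)
  also have "\<dots> \<le> \<Lambda> * peak f A"
    using abs_grad_le_grad_norm[OF G xy] grad_norm_le_peak[OF assms(1-5)] by (rule order_trans)
  finally show ?thesis .
qed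

text \<open>Cutting \<open>\<bar>f\<bar>\<close> off to \<open>0\<close> outside \<open>A\<close> only shrinks the jumps over edges that leave \<open>A\<close>, since \<open>f\<close>
  does not keep its sign there.\<close>

lemma nodal_height_lipschitz:
  assumes G: "weighted_graph V E \<omega>" and eig: "limit_eigenpair V E \<omega> B f \<Lambda>"
    and L: "0 \<le> \<Lambda>" and A: "A \<in> nodal_domains V E f" and xy: "(x, y) \<in> E"
  shows "\<bar>nodal_height f A x - nodal_height f A y\<bar> \<le> \<Lambda> / \<omega> x y"
proof -
  have H: "f \<in> H0 B" using eig by (simp add: limit_eigenpair_def)
  note M = peak_pos[OF G H A]
  have "\<bar>nodal_height f A x - nodal_height f A y\<bar> \<le> \<Lambda> / \<omega> x y"
    if x: "x \<in> A" and xy: "(x, y) \<in> E" for x y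
  proof -
    have w: "\<omega> x y > 0" using G xy unfolding weighted_graph_def by auto
    have "peak f A * \<bar>nodal_height f A x - nodal_height f A y\<bar> \<le> \<bar>f x - f y\<bar>"
    proof (cases "y \<in> A")
      case True
      then have "nodal_height f A x - nodal_height f A y = (\<bar>f x\<bar> - \<bar>f y\<bar>) / peak f A"
        using x by (simp add: nodal_height_def diff_divide_distrib)
      then show ?thesis using M by (simp add: abs_divide)
    next
      case False
      then show ?thesis
        using abs_diff_across_rim[OF G A x xy] x M by (simp add: nodal_height_def)
    qed
    then have "\<omega> x y * (peak f A * \<bar>nodal_height f A x - nodal_height f A y\<bar>) \<le> \<Lambda> * peak f A"
      using edge_jump_le_peak[OF G eig L A x xy] w by (meson less_imp_le mult_left_mono order_trans)
    then show ?thesis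
      using M w by (simp add: field_simps)
  qed
  note from_A = this
  have yx: "(y, x) \<in> E" "\<omega> y x = \<omega> x y" "0 < \<omega> x y"
    using G xy unfolding weighted_graph_def sym_def by auto
  consider "x \<in> A" | "y \<in> A" | "x \<notin> A" "y \<notin> A" by blast
  then show ?thesis
  proof cases
    case 1
    then show ?thesis using from_A xy by blast
  next
    case 2
    then show ?thesis using from_A[OF 2 yx(1)] yx(2) by (simp add: abs_minus_commute)
  next
    case 3
    then show ?thesis using L yx(3) by (simp add: nodal_height_def)
  qed
qed

text \<open>Adding two \<open>\<Lambda>\<close>-Lipschitz functions would in general cost a factor \<open>2\<close>. It does not here: only an
  edge joining \<open>A\<close> directly to \<open>A'\<close> sees both summands. The jump of \<open>f\<close> over this edge is bounded
  by \<open>\<Lambda>\<close> times the smaller of the two peaks, and dividing both heights by the smaller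
  peak only increases their sum.\<close>

lemma nodal_height_diff_lipschitz:
  assumes G: "weighted_graph V E \<omega>" and eig: "limit_eigenpair V E \<omega> B f \<Lambda>"
    and L: "0 \<le> \<Lambda>" and A: "A \<in> nodal_domains V E f" and A': "A' \<in> nodal_domains V E f"
    and "A \<noteq> A'" and xy: "(x, y) \<in> E"
  shows "\<bar>(nodal_height f A x - nodal_height f A' x) - (nodal_height f A y - nodal_height f A' y)\<bar>
    \<le> \<Lambda> / \<omega> x y"
proof -
  have H: "f \<in> H0 B" using eig by (simp add: limit_eigenpair_def)
  have disj: "v \<notin> C'"
    if "C \<in> nodal_domains V E f" "C' \<in> nodal_domains V E f" "C \<noteq> C'" "v \<in> C" for C C' v
    using that nodal_domains_disjoint by metis
  have yx: "(y, x) \<in> E" "\<omega> y x = \<omega> x y" "0 < \<omega> x y"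
    using G xy unfolding weighted_graph_def sym_def by auto
  have crossing: "\<bar>f x\<bar> / peak f C + \<bar>f y\<bar> / peak f C' \<le> \<Lambda> / \<omega> x y"
    if C: "C \<in> nodal_domains V E f" "C' \<in> nodal_domains V E f" "C \<noteq> C'" "x \<in> C" "y \<in> C'"
    for C C'
  proof -
    define m where "m = min (peak f C) (peak f C')"
    have m: "0 < m" "m \<le> peak f C" "m \<le> peak f C'"
      using peak_pos[OF G H] C unfolding m_def by auto
    have "y \<notin> C" using disj[of C' C y] C by auto
    then have jump: "\<bar>f x - f y\<bar> = \<bar>f x\<bar> + \<bar>f y\<bar>"
      using abs_diff_across_rim[OF G C(1,4) xy] by blast
    have "\<omega> x y * \<bar>f x - f y\<bar> \<le> \<Lambda> * peak f C" "\<omega> x y * \<bar>f x - f y\<bar> \<le> \<Lambda> * peak f C'"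
      using edge_jump_le_peak[OF G eig L C(1,4) xy] edge_jump_le_peak[OF G eig L C(2,5) yx(1)]
      by (auto simp: yx(2) abs_minus_commute)
    then have "\<omega> x y * (\<bar>f x\<bar> + \<bar>f y\<bar>) \<le> \<Lambda> * m"
      unfolding jump m_def min_def by auto
    then have "(\<bar>f x\<bar> + \<bar>f y\<bar>) / m \<le> \<Lambda> / \<omega> x y"
      using m(1) yx(3) by (simp add: field_simps)
    moreover have "\<bar>f x\<bar> / peak f C \<le> \<bar>f x\<bar> / m" "\<bar>f y\<bar> / peak f C' \<le> \<bar>f y\<bar> / m"
      using m by (auto intro!: divide_left_mono)
    ultimately show ?thesis
      by (simp add: add_divide_distrib)
  qed
  have nonneg: "0 \<le> \<bar>f v\<bar> / peak f C" if "C \<in> nodal_domains V E f" for v C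
    using peak_pos[OF G H that] by simp
  consider "x \<in> A" "y \<in> A'" | "x \<in> A'" "y \<in> A"
    | "x \<notin> A" "y \<notin> A" | "x \<notin> A'" "y \<notin> A'"
    using disj[OF A A' \<open>A \<noteq> A'\<close>] by blast
  then show ?thesis
  proof cases
    case 1
    then have "x \<notin> A'" "y \<notin> A" using disj A A' \<open>A \<noteq> A'\<close> by metis+
    then show ?thesis
      using crossing[OF A A' \<open>A \<noteq> A'\<close> 1] 1 nonneg[OF A, of x] nonneg[OF A', of y]
      by (simp add: nodal_height_def)
  next
    case 2
    then have "x \<notin> A" "y \<notin> A'" using disj A A' \<open>A \<noteq> A'\<close> by metis+
    then show ?thesis
      using crossing[OF A' A _ 2] \<open>A \<noteq> A'\<close> 2 nonneg[OF A', of x] nonneg[OF A, of y]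
      by (simp add: nodal_height_def)
  next
    case 3
    then have "nodal_height f A x = 0" "nodal_height f A y = 0"
      by (auto simp: nodal_height_def)
    then show ?thesis
      using nodal_height_lipschitz[OF G eig L A' xy] by linarith
  next
    case 4
    then have "nodal_height f A' x = 0" "nodal_height f A' y = 0"
      by (auto simp: nodal_height_def)
    then show ?thesis
      using nodal_height_lipschitz[OF G eig L A xy] by linarith
  qed
qed

section \<open>The packing by peak points\<close>

text \<open>An edge with nonzero gradient has an end point where \<open>f\<close> does not vanish, and an ascent from there
  ends at a point where \<open>\<Lambda> \<bar>f\<bar>\<close> is positive.\<close>

lemma limit_eigenvalue_nonneg:
  assumes G: "weighted_graph V E \<omega>" and eig: "limit_eigenpair V E \<omega> B f \<Lambda>"
    and flat: "(\<forall>(u, v) \<in> E. grad \<omega> f u v = 0) \<longrightarrow> 0 \<le> \<Lambda>"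
  shows "0 \<le> \<Lambda>"
proof (cases "\<forall>(u, v) \<in> E. grad \<omega> f u v = 0")
  case True
  then show ?thesis using flat by blast
next
  case False
  then obtain u v where uv: "(u, v) \<in> E" "grad \<omega> f u v \<noteq> 0" by auto
  have vu: "(v, u) \<in> E" "grad \<omega> f v u \<noteq> 0"
    using G uv grad_swap[OF G uv(1), of f] unfolding weighted_graph_def sym_def by auto
  have "f u \<noteq> 0 \<or> f v \<noteq> 0"
    using uv(2) by (auto simp: grad_def)
  then obtain x y where xy: "(x, y) \<in> E" "grad \<omega> f x y \<noteq> 0" "f x \<noteq> 0"
    using uv vu by blast
  define A where "A = {z \<in> V. f z \<noteq> 0}"
  have V: "finite V" "E \<subseteq> V \<times> V"
    using G unfolding weighted_graph_def by auto
  have "0 < grad_norm E \<omega> f x"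
    using abs_grad_le_grad_norm[OF G xy(1), of f] xy(2) by linarith
  moreover have "limit_eigen_eq E \<omega> f \<Lambda> z" if "z \<in> A" for z
    using eig that unfolding A_def limit_eigenpair_def H0_def by auto
  moreover have "z' \<in> A" if "z \<in> A" "(z, z') \<in> E" "sgn (f z) = sgn (f z')" for z z'
    using that V(2) unfolding A_def by (auto simp: sgn_if split: if_splits)
  moreover have "finite A" "x \<in> A"
    using V xy unfolding A_def by auto
  ultimately obtain z where "grad_norm E \<omega> f x \<le> \<Lambda> * \<bar>f z\<bar>"
    using ascent_to_saturation[OF G, of A f \<Lambda> x] unfolding A_def by blast
  then have "0 < \<Lambda> * \<bar>f z\<bar>"
    using \<open>0 < grad_norm E \<omega> f x\<close> by linarith
  then show ?thesis
    by (simp add: zero_less_mult_iff)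
qed

text \<open>The division is in the extended reals: for \<open>\<Lambda> = 0\<close> the radius is infinite.\<close>

lemma packable_inverse_eigenvalue:
  assumes G: "weighted_graph V E \<omega>" and eig: "limit_eigenpair V E \<omega> B f \<Lambda>"
    and L: "0 \<le> \<Lambda>" and card: "card (nodal_domains V E f) = k"
  shows "packable V E \<omega> B k (1 / ereal \<Lambda>)"
proof -
  have H: "f \<in> H0 B" using eig by (simp add: limit_eigenpair_def)
  have "nodal_domains V E f \<subseteq> Pow V" "finite V"
    using G unfolding nodal_domains_def sign_connected_def weighted_graph_def by auto
  then have "finite (nodal_domains V E f)"
    by (meson finite_Pow_iff finite_subset)
  then obtain D where D: "bij_betw D {1..k} (nodal_domains V E f)"
    using ex_bij_betw_nat_finite_1 card by metis
  have DA: "D i \<in> nodal_domains V E f" if "i \<in> {1..k}" for i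
    using D that bij_betwE by blast
  have "\<exists>u. u \<in> D i \<and> \<bar>f u\<bar> = peak f (D i)" if "i \<in> {1..k}" for i
    using peak_attained nodal_domain_basics(1,2)[OF G H DA[OF that]] by blast
  then obtain u where u: "\<And>i. i \<in> {1..k} \<Longrightarrow> u i \<in> D i \<and> \<bar>f (u i)\<bar> = peak f (D i)"
    by metis
  have at_peak: "nodal_height f (D i) (u i) = 1" if "i \<in> {1..k}" for i
    using u[OF that] peak_pos[OF G H DA[OF that]] by (simp add: nodal_height_def)
  have "u i \<in> V - B" if "i \<in> {1..k}" for i
    using nodal_domain_basics(3)[OF G H DA[OF that]] u[OF that] by auto
  moreover have "2 * (1 / ereal \<Lambda>) \<le> path_dist V E \<omega> (u i) (u j)"
    if ij: "i \<in> {1..k}" "j \<in> {1..k}" "i \<noteq> j" for i j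
  proof -
    have ne: "D i \<noteq> D j"
      using D ij unfolding bij_betw_def inj_on_def by blast
    then have "u i \<notin> D j" "u j \<notin> D i"
      using nodal_domains_disjoint DA u ij by metis+
    then have "nodal_height f (D i) (u j) = 0" "nodal_height f (D j) (u i) = 0"
      by (simp_all add: nodal_height_def)
    then have "ereal 2 * (1 / ereal \<Lambda>) \<le> path_dist V E \<omega> (u i) (u j)"
      using at_peak ij
        path_dist_ge_lipschitz[where \<phi> = "\<lambda>x. nodal_height f (D i) x - nodal_height f (D j) x"
          and c = 2 and u = "u i" and v = "u j",
          OF nodal_height_diff_lipschitz[OF G eig L DA[OF ij(1)] DA[OF ij(2)] ne] L]
      by simp
    then show ?thesis by simp
  qed
  moreover have "1 / ereal \<Lambda> \<le> boundary_dist V E \<omega> B (u i)" if i: "i \<in> {1..k}" for i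
    unfolding boundary_dist_def
  proof (rule INF_greatest)
    fix b assume "b \<in> B"
    then have "nodal_height f (D i) b = 0"
      using H by (simp add: nodal_height_def H0_def)
    then have "ereal 1 * (1 / ereal \<Lambda>) \<le> path_dist V E \<omega> (u i) b"
      using at_peak[OF i]
        path_dist_ge_lipschitz[where \<phi> = "nodal_height f (D i)" and c = 1 and u = "u i" and v = b,
          OF nodal_height_lipschitz[OF G eig L DA[OF i]] L]
      by simp
    then show "1 / ereal \<Lambda> \<le> path_dist V E \<omega> (u i) b"
      by (simp flip: one_ereal_def)
  qed
  ultimately show ?thesis
    unfolding packable_def by blast
qed

theorem corollary3p8:
  fixes V B :: "'a set" and E :: "('a \<times> 'a) set" and \<omega> :: "'a \<Rightarrow> 'a \<Rightarrow> real"
    and f :: "'a \<Rightarrow> real" and \<Lambda> :: real and k :: nat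
  assumes "weighted_graph V E \<omega>"
    and "B \<subseteq> V"
    and "induced_connected E (V - B)"
    and "limit_eigenpair V E \<omega> B f \<Lambda>"
    and "(\<forall>(u, v) \<in> E. grad \<omega> f u v = 0) \<longrightarrow> 0 \<le> \<Lambda>"
    and "card (nodal_domains V E f) = k"
  shows "ereal \<Lambda> \<ge> 1 / packing_radius V E \<omega> B k"
proof -
  have L: "0 \<le> \<Lambda>"
    using limit_eigenvalue_nonneg assms(1,4,5) by blast
  define R where "R = packing_radius V E \<omega> B k"
  have pos: "0 < 1 / ereal \<Lambda>"
    using L by (cases "\<Lambda> = 0") (auto simp: one_ereal_def)
  then have "1 / ereal \<Lambda> \<le> R"
    using packable_inverse_eigenvalue[OF assms(1,4) L assms(6)]
    unfolding R_def packing_radius_def by (intro Sup_upper) simp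
  then have "1 / R \<le> ereal \<Lambda>"
  proof (cases R)
    case (real r)
    then have "0 < \<Lambda>" "1 / \<Lambda> \<le> r"
      using \<open>1 / ereal \<Lambda> \<le> R\<close> L by (cases "\<Lambda> = 0"; auto simp: one_ereal_def)+
    moreover from this have "0 < r"
      by (meson divide_pos_pos less_le_trans zero_less_one)
    ultimately show ?thesis
      using real by (simp add: one_ereal_def field_simps)
  qed (use L in auto)
  then show ?thesis
    unfolding R_def .
qed

end
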